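(* Let $\mathfrak g$ be a Lie algebra over a field $\mathbb F$, $I\subset\mathfrak g$ an ideal, $\mathfrak k\subset\mathfrak g$ a subalgebra reductive in $\mathfrak g$, $I_{\mathfrak k}=I\cap\mathfrak k$, and $M$ a $\mathfrak g$-module. For each $q$ there is a Lie algebra action of $\mathfrak g$ on $H^q(I,I_{\mathfrak k};M)$ defined by the formula $x\cdot[c]:=[\theta_{x^+}c]$ for $x\in\mathfrak g$, $c\in Z^q(I,I_{\mathfrak k};M)$. Since $I$ acts trivially, this formula defines an action of $\mathfrak g/I$ on $H^q(I,I_{\mathfrak k};M)$.
   Context: "Reductive in $\mathfrak g$": any $\mathfrak k$-submodules $U\subset V$ of $\mathfrak g$ admit a $\mathfrak k$-invariant complement of $U$ in $V$. Fix a $\mathfrak k$-module decomposition $\mathfrak g=I_{\mathfrak k}\oplus I_L\oplus J_{\mathfrak k}\oplus J_L$ with $I=I_{\mathfrak k}\oplus I_L$ and $\mathfrak k=I_{\mathfrak k}\oplus J_{\mathfrak k}$ (such exists); put $J=J_{\mathfrak k}\oplus J_L$ (it commutes with $I_{\mathfrak k}$), and let $x\mapsto x^+$ be the projection $\mathfrak g=I\oplus J\to J$. $C^q(I;M)=\mathrm{Hom}(\Lambda^qI,M)$ with the Chevalley-Eilenberg differential. For $z\in\mathfrak g$, $\theta_z$ acts on $C^q(I;M)$ by $(\theta_zf)(x_1,\dots,x_q)=z\cdot f(x_1,\dots,x_q)-\sum_jf(x_1,\dots,[z,x_j],\dots,x_q)$; $(i_zf)(x_2,\dots,x_q)=f(z,x_2,\dots,x_q)$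 for $z\in I$. $C^q(I,I_{\mathfrak k};M)$ is the subcomplex of $f$ with $i_yf=0=\theta_yf$ for all $y\in I_{\mathfrak k}$; its cocycles and cohomology are $Z^q(I,I_{\mathfrak k};M)$ and $H^q(I,I_{\mathfrak k};M)$. For $x\in J$, $\theta_x$ preserves $C^q(I,I_{\mathfrak k};M)$ and commutes with $d$. *)

theory Defs
  imports Complex_Main "HOL-Library.Set_Algebras" "HOL-Library.Function_Algebras"
begin

text \<open>
  The given Lie algebra and module live on whole types, but the quotients \<open>\<gg>/I\<close> and
  \<open>H\<^sup>q(I,I\<^sub>\<kk>;M)\<close> are sets of cosets. The structures below therefore have explicit carrier sets,
  so that one notion of Lie algebra and one notion of Lie module serve for all of them.
  Addition is always that of the type; on cosets it is the elementwise sum of sets.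
  The zero is a separate parameter because the zero of a quotient by \<open>U\<close> is the coset \<open>U\<close>.
\<close>

locale vector_space_on =
  fixes V :: "'v::ab_semigroup_add set" and zero :: 'v
    and scale :: "'f::field \<Rightarrow> 'v \<Rightarrow> 'v"
  assumes add_closed: "\<lbrakk>u \<in> V; v \<in> V\<rbrakk> \<Longrightarrow> u + v \<in> V"
    and zero_closed: "zero \<in> V"
    and zero_add: "v \<in> V \<Longrightarrow> zero + v = v"
    and add_inverse: "v \<in> V \<Longrightarrow> \<exists>w\<in>V. v + w = zero"
    and scale_closed: "v \<in> V \<Longrightarrow> scale a v \<in> V"
    and scale_right_distrib: "\<lbrakk>u \<in> V; v \<in> V\<rbrakk> \<Longrightarrow> scale a (u + v) = scale a u + scale a v"
    and scale_left_distrib: "v \<in> V \<Longrightarrow> scale (a + b) v = scale a v + scale b v"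
    and scale_scale: "v \<in> V \<Longrightarrow> scale a (scale b v) = scale (a * b) v"
    and scale_one: "v \<in> V \<Longrightarrow> scale 1 v = v"

lemma vector_space_on_UNIV_iff:
  fixes s :: "'f::field \<Rightarrow> 'v::ab_group_add \<Rightarrow> 'v"
  shows "vector_space_on UNIV 0 s \<longleftrightarrow> vector_space s"
proof
  assume "vector_space_on UNIV 0 s"
  then interpret vector_space_on UNIV 0 s .
  show "vector_space s"
    by unfold_locales
      (simp_all add: scale_right_distrib scale_left_distrib scale_scale scale_one)
next
  assume "vector_space s"
  then interpret vector_space s .
  show "vector_space_on UNIV 0 s"
    by unfold_locales
      (auto simp: scale_right_distrib scale_left_distrib intro: exI[of _ "- _"])
qed

locale lie_algebra_on = vector_space_on L zero scale
  for L :: "'l::ab_semigroup_add set" and zero :: 'l and scale :: "'f::field \<Rightarrow> 'l \<Rightarrow> 'l" +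
  fixes br :: "'l \<Rightarrow> 'l \<Rightarrow> 'l"
  assumes br_closed: "\<lbrakk>x \<in> L; y \<in> L\<rbrakk> \<Longrightarrow> br x y \<in> L"
    and br_add_left: "\<lbrakk>x \<in> L; y \<in> L; z \<in> L\<rbrakk> \<Longrightarrow> br (x + y) z = br x z + br y z"
    and br_add_right: "\<lbrakk>x \<in> L; y \<in> L; z \<in> L\<rbrakk> \<Longrightarrow> br x (y + z) = br x y + br x z"
    and br_scale_left: "\<lbrakk>x \<in> L; y \<in> L\<rbrakk> \<Longrightarrow> br (scale a x) y = scale a (br x y)"
    and br_scale_right: "\<lbrakk>x \<in> L; y \<in> L\<rbrakk> \<Longrightarrow> br x (scale a y) = scale a (br x y)"
    and br_self: "x \<in> L \<Longrightarrow> br x x = zero"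
    and jacobi: "\<lbrakk>x \<in> L; y \<in> L; z \<in> L\<rbrakk> \<Longrightarrow>
      br x (br y z) + br y (br z x) + br z (br x y) = zero"

locale lie_module_on = lie_algebra_on L zeroL scaleL br + V: vector_space_on V zeroV scaleV
  for L :: "'l::ab_semigroup_add set" and zeroL :: 'l and scaleL :: "'f::field \<Rightarrow> 'l \<Rightarrow> 'l"
    and br :: "'l \<Rightarrow> 'l \<Rightarrow> 'l"
    and V :: "'v::ab_semigroup_add set" and zeroV :: 'v and scaleV :: "'f \<Rightarrow> 'v \<Rightarrow> 'v" +
  fixes act :: "'l \<Rightarrow> 'v \<Rightarrow> 'v"
  assumes act_closed: "\<lbrakk>x \<in> L; v \<in> V\<rbrakk> \<Longrightarrow> act x v \<in> V"
    and act_add_left: "\<lbrakk>x \<in> L; y \<in> L; v \<in> V\<rbrakk> \<Longrightarrow> act (x + y) v = act x v + act y v"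
    and act_add_right: "\<lbrakk>x \<in> L; u \<in> V; v \<in> V\<rbrakk> \<Longrightarrow> act x (u + v) = act x u + act x v"
    and act_scale_left: "\<lbrakk>x \<in> L; v \<in> V\<rbrakk> \<Longrightarrow> act (scaleL a x) v = scaleV a (act x v)"
    and act_scale_right: "\<lbrakk>x \<in> L; v \<in> V\<rbrakk> \<Longrightarrow> act x (scaleV a v) = scaleV a (act x v)"
    and act_br: "\<lbrakk>x \<in> L; y \<in> L; v \<in> V\<rbrakk> \<Longrightarrow>
      act (br x y) v + act y (act x v) = act x (act y v)"

definition lie_ideal ::
  "('f::field \<Rightarrow> 'g::ab_group_add \<Rightarrow> 'g) \<Rightarrow> ('g \<Rightarrow> 'g \<Rightarrow> 'g) \<Rightarrow> 'g set \<Rightarrow> bool" where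
  "lie_ideal s br I \<longleftrightarrow> module.subspace s I \<and> (\<forall>x. \<forall>y\<in>I. br x y \<in> I)"

definition lie_subalgebra ::
  "('f::field \<Rightarrow> 'g::ab_group_add \<Rightarrow> 'g) \<Rightarrow> ('g \<Rightarrow> 'g \<Rightarrow> 'g) \<Rightarrow> 'g set \<Rightarrow> bool" where
  "lie_subalgebra s br k \<longleftrightarrow> module.subspace s k \<and> (\<forall>x\<in>k. \<forall>y\<in>k. br x y \<in> k)"

definition ad_submodule ::
  "('f::field \<Rightarrow> 'g::ab_group_add \<Rightarrow> 'g) \<Rightarrow> ('g \<Rightarrow> 'g \<Rightarrow> 'g) \<Rightarrow> 'g set \<Rightarrow> 'g set \<Rightarrow> bool" where
  "ad_submodule s br k U \<longleftrightarrow> module.subspace s U \<and> (\<forall>x\<in>k. \<forall>u\<in>U. br x u \<in> U)"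

text \<open>\<open>W = U \<oplus> V\<close>; applied only to subspaces \<open>U\<close> and \<open>V\<close>.\<close>
definition direct_sum_of :: "'g::ab_group_add set \<Rightarrow> 'g set \<Rightarrow> 'g set \<Rightarrow> bool" where
  "direct_sum_of W U V \<longleftrightarrow> W = U + V \<and> U \<inter> V = {0}"

definition reductive_in ::
  "('f::field \<Rightarrow> 'g::ab_group_add \<Rightarrow> 'g) \<Rightarrow> ('g \<Rightarrow> 'g \<Rightarrow> 'g) \<Rightarrow> 'g set \<Rightarrow> bool" where
  "reductive_in s br k \<longleftrightarrow>
    (\<forall>U V. ad_submodule s br k U \<and> ad_submodule s br k V \<and> U \<subseteq> V \<longrightarrow>
      (\<exists>W. ad_submodule s br k W \<and> direct_sum_of V U W))"

text \<open>The component in \<open>J\<close> of \<open>x\<close>, when the ambient space is \<open>I \<oplus> J\<close>.\<close>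
definition proj_along :: "'g::ab_group_add set \<Rightarrow> 'g set \<Rightarrow> 'g \<Rightarrow> 'g" where
  "proj_along I J x = (THE y. y \<in> J \<and> x - y \<in> I)"


text \<open>
  A \<open>q\<close>-cochain is an alternating \<open>q\<close>-linear map on \<open>I\<close>, i.e. a linear map on \<open>\<Lambda>\<^sup>q I\<close>. It is
  represented by a function on lists that is zero off the lists of length \<open>q\<close> over \<open>I\<close>, so that
  equality of functions is equality of cochains. The operators below need no degree argument
  for this reason.
\<close>

definition tuples :: "'g set \<Rightarrow> nat \<Rightarrow> 'g list set" where
  "tuples I q = {xs. length xs = q \<and> set xs \<subseteq> I}"

definition cochains ::
  "('f::field \<Rightarrow> 'g::ab_group_add \<Rightarrow> 'g) \<Rightarrow> ('f \<Rightarrow> 'm::ab_group_add \<Rightarrow> 'm) \<Rightarrow>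
    'g set \<Rightarrow> nat \<Rightarrow> ('g list \<Rightarrow> 'm) set" where
  "cochains sG sM I q = {f.
     (\<forall>xs. xs \<notin> tuples I q \<longrightarrow> f xs = 0) \<and>
     (\<forall>xs\<in>tuples I q. \<forall>j<q. \<forall>x\<in>I. \<forall>y\<in>I.
        f (xs[j := x + y]) = f (xs[j := x]) + f (xs[j := y])) \<and>
     (\<forall>xs\<in>tuples I q. \<forall>j<q. \<forall>x\<in>I. \<forall>a. f (xs[j := sG a x]) = sM a (f (xs[j := x]))) \<and>
     (\<forall>xs\<in>tuples I q. \<forall>i j. i < j \<and> j < q \<and> xs ! i = xs ! j \<longrightarrow> f xs = 0)}"

definition contract :: "'g \<Rightarrow> ('g list \<Rightarrow> 'm) \<Rightarrow> 'g list \<Rightarrow> 'm" where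
  "contract z f = (\<lambda>xs. f (z # xs))"

definition theta ::
  "('g \<Rightarrow> 'g \<Rightarrow> 'g) \<Rightarrow> ('g \<Rightarrow> 'm::ab_group_add \<Rightarrow> 'm) \<Rightarrow> 'g set \<Rightarrow> 'g \<Rightarrow>
    ('g list \<Rightarrow> 'm) \<Rightarrow> 'g list \<Rightarrow> 'm" where
  "theta br act I z f = (\<lambda>xs. if set xs \<subseteq> I
     then act z (f xs) - (\<Sum>j<length xs. f (xs[j := br z (xs ! j)])) else 0)"

text \<open>
  The Chevalley-Eilenberg differential; \<open>nths xs (- {i})\<close> is \<open>xs\<close> with the entry at position \<open>i\<close>
  omitted. Positions are counted from \<open>0\<close>.
\<close>
definition ce_diff ::
  "('f::field \<Rightarrow> 'm::ab_group_add \<Rightarrow> 'm) \<Rightarrow> ('g \<Rightarrow> 'g \<Rightarrow> 'g) \<Rightarrow> ('g \<Rightarrow> 'm \<Rightarrow> 'm) \<Rightarrow>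
    'g set \<Rightarrow> ('g list \<Rightarrow> 'm) \<Rightarrow> 'g list \<Rightarrow> 'm" where
  "ce_diff sM br act I f = (\<lambda>xs. if set xs \<subseteq> I then
       (\<Sum>i<length xs. sM ((-1) ^ i) (act (xs ! i) (f (nths xs (- {i}))))) +
       (\<Sum>j<length xs. \<Sum>i<j. sM ((-1) ^ (i + j)) (f (br (xs ! i) (xs ! j) # nths xs (- {i, j}))))
     else 0)"

definition rel_cochains ::
  "('f::field \<Rightarrow> 'g::ab_group_add \<Rightarrow> 'g) \<Rightarrow> ('f \<Rightarrow> 'm::ab_group_add \<Rightarrow> 'm) \<Rightarrow>
    ('g \<Rightarrow> 'g \<Rightarrow> 'g) \<Rightarrow> ('g \<Rightarrow> 'm \<Rightarrow> 'm) \<Rightarrow> 'g set \<Rightarrow> 'g set \<Rightarrow> nat \<Rightarrow> ('g list \<Rightarrow> 'm) set" where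
  "rel_cochains sG sM br act I Ik q =
    {f \<in> cochains sG sM I q. \<forall>y\<in>Ik. contract y f = 0 \<and> theta br act I y f = 0}"

definition rel_cocycles ::
  "('f::field \<Rightarrow> 'g::ab_group_add \<Rightarrow> 'g) \<Rightarrow> ('f \<Rightarrow> 'm::ab_group_add \<Rightarrow> 'm) \<Rightarrow>
    ('g \<Rightarrow> 'g \<Rightarrow> 'g) \<Rightarrow> ('g \<Rightarrow> 'm \<Rightarrow> 'm) \<Rightarrow> 'g set \<Rightarrow> 'g set \<Rightarrow> nat \<Rightarrow> ('g list \<Rightarrow> 'm) set" where
  "rel_cocycles sG sM br act I Ik q =
    {f \<in> rel_cochains sG sM br act I Ik q. ce_diff sM br act I f = 0}"

definition rel_coboundaries ::
  "('f::field \<Rightarrow> 'g::ab_group_add \<Rightarrow> 'g) \<Rightarrow> ('f \<Rightarrow> 'm::ab_group_add \<Rightarrow> 'm) \<Rightarrow>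
    ('g \<Rightarrow> 'g \<Rightarrow> 'g) \<Rightarrow> ('g \<Rightarrow> 'm \<Rightarrow> 'm) \<Rightarrow> 'g set \<Rightarrow> 'g set \<Rightarrow> nat \<Rightarrow> ('g list \<Rightarrow> 'm) set" where
  "rel_coboundaries sG sM br act I Ik q =
    (case q of 0 \<Rightarrow> {0} | Suc p \<Rightarrow> ce_diff sM br act I ` rel_cochains sG sM br act I Ik p)"

definition cochain_scale :: "('f \<Rightarrow> 'm \<Rightarrow> 'm) \<Rightarrow> 'f \<Rightarrow> ('g list \<Rightarrow> 'm) \<Rightarrow> 'g list \<Rightarrow> 'm" where
  "cochain_scale sM a f = (\<lambda>xs. sM a (f xs))"


text \<open>
  The quotient of a subspace \<open>Z\<close> by a subspace \<open>U\<close>: its elements are the cosets \<open>z +o U\<close>, its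
  addition is the sum of sets, its zero is \<open>U\<close>. Adding \<open>U\<close> in the operations below makes the
  result a full coset; for instance \<open>0\<close> times a coset has to be \<open>U\<close>, not \<open>{0}\<close>.
\<close>

definition quot :: "'v::ab_group_add set \<Rightarrow> 'v set \<Rightarrow> 'v set set" where
  "quot Z U = (\<lambda>z. z +o U) ` Z"

definition quot_scale ::
  "('f \<Rightarrow> 'v::ab_group_add \<Rightarrow> 'v) \<Rightarrow> 'v set \<Rightarrow> 'f \<Rightarrow> 'v set \<Rightarrow> 'v set" where
  "quot_scale s U a A = s a ` A + U"

definition quot_br ::
  "('g::ab_group_add \<Rightarrow> 'g \<Rightarrow> 'g) \<Rightarrow> 'g set \<Rightarrow> 'g set \<Rightarrow> 'g set \<Rightarrow> 'g set" where
  "quot_br br U A B = {br x y | x y. x \<in> A \<and> y \<in> B} + U"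

definition rel_cohomology ::
  "('f::field \<Rightarrow> 'g::ab_group_add \<Rightarrow> 'g) \<Rightarrow> ('f \<Rightarrow> 'm::ab_group_add \<Rightarrow> 'm) \<Rightarrow>
    ('g \<Rightarrow> 'g \<Rightarrow> 'g) \<Rightarrow> ('g \<Rightarrow> 'm \<Rightarrow> 'm) \<Rightarrow> 'g set \<Rightarrow> 'g set \<Rightarrow> nat \<Rightarrow> ('g list \<Rightarrow> 'm) set set" where
  "rel_cohomology sG sM br act I Ik q =
    quot (rel_cocycles sG sM br act I Ik q) (rel_coboundaries sG sM br act I Ik q)"

end

theory Submission
  imports Defs
begin

text \<open>
  An element \<open>z\<close> of \<open>I\<close> centralising \<open>I\<^sub>\<kk>\<close> acts trivially on relative cohomology: \<open>i\<^sub>z\<close> preserves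
  the relative cochains, so Cartan's formula \<open>\<theta>\<^sub>z = d i\<^sub>z + i\<^sub>z d\<close> makes \<open>\<theta>\<^sub>z c\<close> a coboundary for
  every relative cocycle \<open>c\<close>. Now \<open>[I\<^sub>\<kk>, J] \<subseteq> I \<inter> J = 0\<close>, so by the Jacobi identity
  \<open>[x,y]\<^sup>+ - [x\<^sup>+,y\<^sup>+]\<close>, which lies in \<open>I\<close>, centralises \<open>I\<^sub>\<kk>\<close>. Hence \<open>\<theta>\<^bsub>[x,y]\<^sup>+\<^esub>\<close> and the
  commutator of \<open>\<theta>\<^bsub>x\<^sup>+\<^esub>\<close> and \<open>\<theta>\<^bsub>y\<^sup>+\<^esub>\<close> agree on cohomology.
\<close>

subsection \<open>Quotients\<close>

lemma coset_add:
  assumes "module.subspace s U" "vector_space s"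
  shows "(x +o U) + (y +o U) = (x + y) +o U"
proof -
  interpret vector_space s by fact
  have "U + U = U"
    using assms(1) by (force simp: set_plus_def subspace_0 intro: subspace_add)
  then show ?thesis by (simp add: set_plus_rearrange)
qed

lemma coset_eqI:
  assumes "module.subspace s U" "vector_space s" "x - y \<in> U"
  shows "x +o U = y +o U"
proof -
  interpret vector_space s by fact
  have "\<exists>v\<in>U. x + u = y + v" if "u \<in> U" for u
    using that assms by (intro bexI[of _ "x - y + u"]) (auto intro: subspace_add)
  moreover have "\<exists>v\<in>U. y + u = x + v" if "u \<in> U" for u
    using that assms by (intro bexI[of _ "u - (x - y)"]) (auto intro: subspace_diff)
  ultimately show ?thesis by (auto simp: elt_set_plus_def)
qed

text \<open>\<open>T\<close> need not map \<open>U\<close> onto \<open>U\<close>, so the image of a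
  coset can be too small; adding \<open>U\<close> fills it up. Scalar multiplication and the actions
  on quotients both have this form.\<close>

lemma image_coset:
  assumes "module.subspace s U" "vector_space s"
    and "\<And>u v. T (u + v) = T u + T v" "\<And>u. u \<in> U \<Longrightarrow> T u \<in> U"
  shows "T ` (x +o U) + U = T x +o U"
proof -
  interpret vector_space s by fact
  show ?thesis
  proof (intro set_eqI iffI)
    fix z assume "z \<in> T ` (x +o U) + U"
    then obtain u v where "u \<in> U" "v \<in> U" "z = T x + (T u + v)"
      by (auto simp: elt_set_plus_def set_plus_def assms(3) add.assoc)
    then show "z \<in> T x +o U"
      using assms by (auto simp: elt_set_plus_def intro: subspace_add)
  next
    fix z assume "z \<in> T x +o U"
    moreover have "T x \<in> T ` (x +o U)"
      using subspace_0[OF assms(1)] by (force simp: elt_set_plus_def)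
    ultimately show "z \<in> T ` (x +o U) + U"
      by (auto simp: elt_set_plus_def set_plus_def)
  qed
qed

lemma quot_scale_coset:
  assumes "module.subspace s U" "vector_space s"
  shows "quot_scale s U a (x +o U) = s a x +o U"
proof -
  interpret vector_space s by fact
  show ?thesis unfolding quot_scale_def
    by (rule image_coset[OF assms]) (use assms in \<open>auto intro: subspace_scale simp: scale_right_distrib\<close>)
qed

lemma zero_coset: "0 +o U = (U :: 'v::ab_group_add set)"
  by (simp add: elt_set_plus_def)

lemma quot_cases:
  assumes "A \<in> quot Z U" obtains x where "x \<in> Z" "A = x +o U"
  using assms by (auto simp: quot_def)

lemma coset_in_quot: "x \<in> Z \<Longrightarrow> x +o U \<in> quot Z U"
  by (simp add: quot_def)

lemma vector_space_on_quot:
  assumes "vector_space s" "module.subspace s Z" "module.subspace s U"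
  shows "vector_space_on (quot Z U) U (quot_scale s U)"
proof -
  interpret vector_space s by fact
  note [simp] = coset_add[OF assms(3,1)] quot_scale_coset[OF assms(3,1)]
  have zero: "U \<in> quot Z U"
    using coset_in_quot[of 0 Z U] assms(2) by (simp add: subspace_0 zero_coset)
  have zero_add: "U + (x +o U) = x +o U" for x
    using coset_add[OF assms(3,1), of 0 x] by (simp add: zero_coset)
  show ?thesis
  proof (unfold_locales, goal_cases)
    \<comment> \<open>The fourth goal is \<open>add_inverse\<close>; the coset of \<open>- x\<close>
      is the inverse.\<close>
    case (4 v)
    then obtain x where "x \<in> Z" "v = x +o U" by (rule quot_cases)
    then show ?case
      using assms(2) by (intro bexI[of _ "(- x) +o U"]) (auto simp: zero_coset intro: coset_in_quot subspace_neg)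
  qed (use assms(2) zero zero_add in \<open>auto elim!: quot_cases intro!: coset_in_quot
      intro: subspace_add subspace_scale simp: scale_left_distrib scale_right_distrib\<close>)
qed

text \<open>The operators have to respect brackets only modulo \<open>U\<close>. This is the form
  needed for \<theta> of projected elements, since projecting to a complement of an ideal need not
  preserve brackets.\<close>

lemma lie_module_on_quot:
  assumes L: "lie_algebra_on L zeroL sL br"
    and s: "vector_space s" and Z: "module.subspace s Z" and U: "module.subspace s U"
    and T_add: "\<And>x u v. T x (u + v) = T x u + T x v"
    and T_scale: "\<And>x a v. T x (s a v) = s a (T x v)"
    and T_Z: "\<And>x v. x \<in> L \<Longrightarrow> v \<in> Z \<Longrightarrow> T x v \<in> Z"
    and T_U: "\<And>x v. x \<in> L \<Longrightarrow> v \<in> U \<Longrightarrow> T x v \<in> U"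
    and add_T: "\<And>x y v. x \<in> L \<Longrightarrow> y \<in> L \<Longrightarrow> v \<in> Z \<Longrightarrow> T (x + y) v = T x v + T y v"
    and scale_T: "\<And>x a v. x \<in> L \<Longrightarrow> v \<in> Z \<Longrightarrow> T (sL a x) v = s a (T x v)"
    and br_T: "\<And>x y v. x \<in> L \<Longrightarrow> y \<in> L \<Longrightarrow> v \<in> Z \<Longrightarrow> T (br x y) v + T y (T x v) - T x (T y v) \<in> U"
  shows "lie_module_on L zeroL sL br (quot Z U) U (quot_scale s U) (\<lambda>x A. T x ` A + U)"
proof -
  interpret s: vector_space s by fact
  interpret L: lie_algebra_on L zeroL sL br by fact
  interpret Q: vector_space_on "quot Z U" U "quot_scale s U"
    by (rule vector_space_on_quot) fact+
  have [simp]: "T x ` (v +o U) + U = T x v +o U" if "x \<in> L" for x v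
    using that by (intro image_coset[OF U s]) (auto simp: T_add T_U)
  note [simp] = coset_add[OF U s] quot_scale_coset[OF U s]
  show ?thesis
  proof (unfold_locales, goal_cases)
    \<comment> \<open>The sixth goal is \<open>act_br\<close>, the one identity that is available
      only modulo \<open>U\<close>.\<close>
    case (6 x y v)
    then obtain c where "c \<in> Z" "v = c +o U" by (auto elim: quot_cases)
    with 6 show ?case
      using coset_eqI[OF U s br_T] by (simp add: L.br_closed)
  qed (auto elim!: quot_cases intro!: coset_in_quot
      simp: T_Z T_add T_scale add_T scale_T L.add_closed L.scale_closed)
qed

text \<open>For \<open>u\<close> and \<open>v\<close> in \<open>I\<close>, expanding
  \<open>br (x + u) (y + v)\<close> gives \<open>br x y\<close> and three terms that the ideal
  absorbs, so all representatives yield the same coset.\<close>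

lemma lie_algebra_on_quot:
  assumes "lie_algebra_on UNIV 0 s br" "lie_ideal s br I"
  shows "lie_algebra_on (quot UNIV I) I (quot_scale s I) (quot_br br I)"
    and "\<And>x y. quot_br br I (x +o I) (y +o I) = br x y +o I"
proof -
  interpret lie_algebra_on UNIV 0 s br by fact
  have vs: "vector_space s"
    using vector_space_on_UNIV_iff vector_space_on_axioms by blast
  interpret s: vector_space s by fact
  have I: "s.subspace I"
    using assms(2) by (simp add: lie_ideal_def)
  have ideal: "br x y \<in> I" if "y \<in> I" for x y
    using assms(2) that by (simp add: lie_ideal_def)
  have add: "br (x + y) z = br x z + br y z" "br z (x + y) = br z x + br z y" for x y z
    by (simp_all add: br_add_left br_add_right)
  have skew: "br x y + br y x = 0" for x y
    using br_self[of "x + y"] by (simp add: add br_self add.commute)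
  \<comment> \<open>\<open>lie_ideal\<close> absorbs in the second argument; skew symmetry carries
    this over to the first.\<close>
  have ideal': "br y x \<in> I" if "y \<in> I" for x y
    using skew[of y x] ideal[OF that, of x] I s.subspace_neg by (metis add_eq_0_iff2 add.commute)
  show quot_br: "quot_br br I (x +o I) (y +o I) = br x y +o I" for x y
  proof (intro set_eqI iffI)
    fix z assume "z \<in> quot_br br I (x +o I) (y +o I)"
    then obtain u v w where "u \<in> I" "v \<in> I" "w \<in> I" "z = br (x + u) (y + v) + w"
      by (auto simp: quot_br_def elt_set_plus_def set_plus_def)
    moreover from this have "z = br x y + (br x v + (br u y + br u v) + w)"
      by (simp add: add add.assoc)
    moreover have "br x v + (br u y + br u v) + w \<in> I"
      using calculation by (intro s.subspace_add[OF I] ideal ideal')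
    ultimately show "z \<in> br x y +o I"
      by (auto simp: elt_set_plus_def add.assoc)
  next
    fix z assume "z \<in> br x y +o I"
    then obtain w where "w \<in> I" "z = br x y + w" by (auto simp: elt_set_plus_def)
    moreover have "x \<in> x +o I" "y \<in> y +o I"
      using s.subspace_0[OF I] by (force simp: elt_set_plus_def)+
    ultimately show "z \<in> quot_br br I (x +o I) (y +o I)"
      unfolding quot_br_def by blast
  qed
  interpret Q: vector_space_on "quot UNIV I" I "quot_scale s I"
    by (rule vector_space_on_quot) (auto simp: vs I)
  note [simp] = coset_add[OF I vs] quot_scale_coset[OF I vs] quot_br
  show "lie_algebra_on (quot UNIV I) I (quot_scale s I) (quot_br br I)"
    by unfold_locales
      (auto elim!: quot_cases intro!: coset_in_quot
        simp: add br_scale_left br_scale_right br_self jacobi zero_coset)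
qed

text \<open>If \<open>I\<close> acts as zero, the action of \<open>x\<close> depends only on the
  coset of \<open>x\<close>, and all module laws descend.\<close>

lemma lie_module_on_quot_algebra:
  assumes "lie_module_on UNIV 0 s br V zeroV sV act" "lie_ideal s br I"
    and trivial: "\<And>x v. x \<in> I \<Longrightarrow> v \<in> V \<Longrightarrow> act x v = zeroV"
  obtains actQ where "lie_module_on (quot UNIV I) I (quot_scale s I) (quot_br br I) V zeroV sV actQ"
    and "\<And>x v. v \<in> V \<Longrightarrow> actQ (x +o I) v = act x v"
proof
  interpret lie_module_on UNIV 0 s br V zeroV sV act by fact
  have vs: "vector_space s"
    using vector_space_on_UNIV_iff vector_space_on_axioms by blast
  interpret s: vector_space s by fact
  have I: "s.subspace I"
    using assms(2) by (auto simp: lie_ideal_def)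
  \<comment> \<open>Some representative of the coset acts; the next fact shows that the choice does
    not matter.\<close>
  define actQ where "actQ A v = act (SOME x. x \<in> A) v" for A v
  show actQ: "actQ (x +o I) v = act x v" if "v \<in> V" for x v
  proof -
    have "x \<in> x +o I"
      using s.subspace_0[OF I] by (force simp: elt_set_plus_def)
    then have "(SOME y. y \<in> x +o I) \<in> x +o I" by (rule someI)
    then obtain u where "u \<in> I" "(SOME y. y \<in> x +o I) = x + u"
      by (auto simp: elt_set_plus_def)
    with that show ?thesis
      using V.zero_add[OF act_closed[of x v]]
      by (simp add: actQ_def act_add_left trivial add.commute)
  qed
  interpret Q: lie_algebra_on "quot UNIV I" I "quot_scale s I" "quot_br br I"
    by (rule lie_algebra_on_quot) (use assms(2) in \<open>auto intro: lie_algebra_on_axioms\<close>)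
  note [simp] = coset_add[OF I vs] quot_scale_coset[OF I vs]
    lie_algebra_on_quot(2)[OF lie_algebra_on_axioms assms(2)] actQ
  show "lie_module_on (quot UNIV I) I (quot_scale s I) (quot_br br I) V zeroV sV actQ"
    by unfold_locales
      (auto elim!: quot_cases simp: act_closed act_add_left act_add_right act_scale_left
        act_scale_right act_br V.add_closed V.scale_closed)
qed

subsection \<open>Projection along a subspace\<close>

text \<open>Two candidates for the component in \<open>J\<close> differ by an element of
  \<open>I \<inter> J\<close>. This uniqueness later makes the projection linear.\<close>

lemma proj_along_eq:
  assumes "vector_space s" "module.subspace s I" "module.subspace s J" "direct_sum_of UNIV I J"
    and "y \<in> J" "x - y \<in> I"
  shows "proj_along I J x = y"
  unfolding proj_along_def
proof (rule the_equality)
  interpret vector_space s by fact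
  show "z = y" if "z \<in> J \<and> x - z \<in> I" for z
  proof -
    have "z - y \<in> J" using that assms by (auto intro: subspace_diff)
    moreover have "(x - y) - (x - z) \<in> I"
      by (rule subspace_diff) (use that assms in auto)
    ultimately have "z - y \<in> I \<inter> J" by simp
    with assms(4) show ?thesis by (simp add: direct_sum_of_def)
  qed
qed (use assms in simp)

lemma proj_along_mem:
  assumes "vector_space s" "module.subspace s I" "module.subspace s J" "direct_sum_of UNIV I J"
  shows "proj_along I J x \<in> J" "x - proj_along I J x \<in> I"
proof -
  have "x \<in> I + J" using assms(4) unfolding direct_sum_of_def by blast
  then obtain u y where "u \<in> I" "y \<in> J" "x = u + y" by (auto simp: set_plus_def)
  then have "y \<in> J" "x - y \<in> I" by auto
  with proj_along_eq[OF assms this] show "proj_along I J x \<in> J" "x - proj_along I J x \<in> I" by auto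
qed

subsection \<open>Cochains on an ideal\<close>

locale lie_module_ideal = lie_module_on UNIV 0 sG br UNIV 0 sM act
  for sG :: "'f::field \<Rightarrow> 'g::ab_group_add \<Rightarrow> 'g" and br
    and sM :: "'f \<Rightarrow> 'm::ab_group_add \<Rightarrow> 'm" and act +
  fixes I :: "'g set"
  assumes ideal: "lie_ideal sG br I"
begin

interpretation G: vector_space sG
  using vector_space_on_UNIV_iff vector_space_on_axioms by blast

interpretation M: vector_space sM
  using vector_space_on_UNIV_iff V.vector_space_on_axioms by blast

abbreviation "\<theta> \<equiv> theta br act I"
abbreviation "d \<equiv> ce_diff sM br act I"

lemma I_subspace: "G.subspace I"
  using ideal by (simp add: lie_ideal_def)

lemma br_I: "y \<in> I \<Longrightarrow> br x y \<in> I"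
  using ideal by (simp add: lie_ideal_def)

lemmas I_add = G.subspace_add[OF I_subspace] and I_scale = G.subspace_scale[OF I_subspace]
  and I_zero = G.subspace_0[OF I_subspace]

lemma br_add: "br (x + y) z = br x z + br y z" "br z (x + y) = br z x + br z y"
  by (simp_all add: br_add_left br_add_right)

lemma br_zero: "br 0 x = 0" "br x 0 = 0"
  using br_add(1)[of 0 0 x] br_add(2)[of x 0 0] by simp_all

lemma br_skew: "br y x = - br x y"
proof -
  have "br x y + br y x = 0"
    using br_self[of "x + y"] by (simp add: br_add br_self add.commute)
  then show ?thesis by (simp add: eq_neg_iff_add_eq_0 add.commute)
qed

lemma br_minus: "br (- x) y = - br x y"
  using br_add(1)[of x "- x" y] by (simp add: br_zero eq_neg_iff_add_eq_0 add.commute)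

lemma br_diff: "br (x - y) z = br x z - br y z"
  using br_add(1)[of x "- y" z] by (simp add: br_minus)

text \<open>The Jacobi identity solved for the nested bracket on the left: as a rewrite rule it
  shows that elements centralising \<open>z\<close> have brackets centralising
  \<open>z\<close>.\<close>

lemma br_br: "br (br x y) z = br x (br y z) - br y (br x z)"
proof -
  have "br x (br y z) + br y (br z x) + br z (br x y) = 0" by (simp add: jacobi)
  moreover have "br z (br x y) = - br (br x y) z" by (rule br_skew)
  moreover have "br y (br z x) = - br y (br x z)"
    using br_skew[of x z] br_skew[of y "br x z"] br_skew[of "br z x" y] by (simp add: br_minus)
  ultimately show ?thesis by (simp add: algebra_simps)
qed

lemma act_add: "act (x + y) v = act x v + act y v" "act x (u + v) = act x u + act x v"
  by (simp_all add: act_add_left act_add_right)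

lemma act_zero: "act 0 v = 0" "act x 0 = 0"
  using act_add(1)[of 0 0 v] act_add(2)[of x 0 0] by simp_all

lemma act_commutator: "act (br x y) v = act x (act y v) - act y (act x v)"
  using act_br[of x y v] by (simp add: eq_diff_eq)

text \<open>
  Cochains of unspecified degree. Alternation is required for adjacent equal entries only, so
  that contraction reduces every property to one about the first two entries.
\<close>
definition alt :: "('g list \<Rightarrow> 'm) set" where
  "alt = {f. (\<forall>xs. \<not> set xs \<subseteq> I \<longrightarrow> f xs = 0) \<and>
    (\<forall>us vs. \<forall>x\<in>I. \<forall>y\<in>I. f (us @ (x + y) # vs) = f (us @ x # vs) + f (us @ y # vs)) \<and>
    (\<forall>us vs. \<forall>x\<in>I. \<forall>a. f (us @ sG a x # vs) = sM a (f (us @ x # vs))) \<and>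
    (\<forall>us vs x. f (us @ x # x # vs) = 0)}"

lemma altI:
  assumes "\<And>xs. \<not> set xs \<subseteq> I \<Longrightarrow> f xs = 0"
    and "\<And>us vs x y. x \<in> I \<Longrightarrow> y \<in> I \<Longrightarrow> f (us @ (x + y) # vs) = f (us @ x # vs) + f (us @ y # vs)"
    and "\<And>us vs x a. x \<in> I \<Longrightarrow> f (us @ sG a x # vs) = sM a (f (us @ x # vs))"
    and "\<And>us vs x. f (us @ x # x # vs) = 0"
  shows "f \<in> alt"
  using assms by (simp add: alt_def)

lemma
  assumes "f \<in> alt"
  shows alt_outside: "\<not> set xs \<subseteq> I \<Longrightarrow> f xs = 0"
    and alt_add: "x \<in> I \<Longrightarrow> y \<in> I \<Longrightarrow> f (us @ (x + y) # vs) = f (us @ x # vs) + f (us @ y # vs)"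
    and alt_scale: "x \<in> I \<Longrightarrow> f (us @ sG a x # vs) = sM a (f (us @ x # vs))"
    and alt_adjacent: "f (us @ x # x # vs) = 0"
  using assms by (simp_all add: alt_def)

text \<open>Polarisation: expand the vanishing value with \<open>x + y\<close> in both places. If an
  entry lies outside \<open>I\<close>, both sides are zero.\<close>

lemma alt_swap:
  assumes "f \<in> alt"
  shows "f (us @ x # y # vs) = - f (us @ y # x # vs)"
proof (cases "x \<in> I \<and> y \<in> I")
  case True
  have "0 = f (us @ (x + y) # (x + y) # vs)" using alt_adjacent[OF assms] by simp
  also have "\<dots> = f (us @ x # (x + y) # vs) + f (us @ y # (x + y) # vs)"
    using True by (simp add: alt_add[OF assms])
  also have "\<dots> = f (us @ x # y # vs) + f (us @ y # x # vs)"
    using True alt_add[OF assms, of x y "us @ [x]" vs] alt_add[OF assms, of x y "us @ [y]" vs]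
      alt_adjacent[OF assms]
    by simp
  finally show ?thesis by (simp add: eq_neg_iff_add_eq_0)
next
  case False
  then show ?thesis using alt_outside[OF assms] by auto
qed

text \<open>Adjacent swaps carry the first \<open>x\<close> to the right until it meets the second
  one.\<close>

lemma alt_repeat:
  assumes "f \<in> alt"
  shows "f (us @ x # vs @ x # ws) = 0"
proof (induction vs arbitrary: us)
  case Nil
  then show ?case using alt_adjacent[OF assms] by simp
next
  case (Cons v vs)
  have "f (us @ x # (v # vs) @ x # ws) = - f (us @ v # x # (vs @ x # ws))"
    using alt_swap[OF assms, of us x v "vs @ x # ws"] by simp
  then show ?case using Cons.IH[of "us @ [v]"] by simp
qed

text \<open>Cochains of degree \<open>q\<close> are the members of \<open>alt\<close> concentrated
  on lists of length \<open>q\<close>. Alternation at distant positions comes from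
  \<open>alt_repeat\<close>, so later proofs can avoid positions.\<close>

lemma cochains_eq: "cochains sG sM I q = {f \<in> alt. \<forall>xs. length xs \<noteq> q \<longrightarrow> f xs = 0}"
proof (intro equalityI subsetI)
  fix f assume f: "f \<in> cochains sG sM I q"
  have 0: "f xs = 0" if "xs \<notin> tuples I q" for xs
    using f that unfolding cochains_def by blast
  have "f \<in> alt"
  proof (rule altI)
    fix us vs x y assume I: "x \<in> I" "y \<in> I"
    show "f (us @ (x + y) # vs) = f (us @ x # vs) + f (us @ y # vs)"
    proof (cases "us @ x # vs \<in> tuples I q")
      case True
      then have "length us < q" by (auto simp: tuples_def)
      with True f I have "f ((us @ x # vs)[length us := x + y]) =
        f ((us @ x # vs)[length us := x]) + f ((us @ x # vs)[length us := y])"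
        unfolding cochains_def by blast
      then show ?thesis by simp
    next
      case False
      \<comment> \<open>Exchanging an entry in \<open>I\<close> for another one in \<open>I\<close>
        cannot produce a list in \<open>tuples I q\<close>, so every term of the equation is
        zero.\<close>
      with I have "us @ z # vs \<notin> tuples I q" if "z \<in> I" for z
        using that by (auto simp: tuples_def)
      with I show ?thesis by (simp add: 0 I_add)
    qed
  next
    fix us vs x a assume I: "x \<in> I"
    show "f (us @ sG a x # vs) = sM a (f (us @ x # vs))"
    proof (cases "us @ x # vs \<in> tuples I q")
      case True
      then have "length us < q" by (auto simp: tuples_def)
      with True f I have "f ((us @ x # vs)[length us := sG a x]) = sM a (f ((us @ x # vs)[length us := x]))"
        unfolding cochains_def by blast
      then show ?thesis by simp
    next
      case False
      with I have "us @ z # vs \<notin> tuples I q" if "z \<in> I" for z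
        using that by (auto simp: tuples_def)
      with I show ?thesis by (simp add: 0 I_scale)
    qed
  next
    fix us vs x
    show "f (us @ x # x # vs) = 0"
    proof (cases "us @ x # x # vs \<in> tuples I q")
      case True
      then have "length us < Suc (length us)" "Suc (length us) < q" by (auto simp: tuples_def)
      moreover have "(us @ x # x # vs) ! length us = (us @ x # x # vs) ! Suc (length us)"
        by (simp add: nth_append)
      ultimately show ?thesis using True f unfolding cochains_def by blast
    qed (rule 0)
  qed (use 0 in \<open>simp add: tuples_def\<close>)
  with 0 show "f \<in> {f \<in> alt. \<forall>xs. length xs \<noteq> q \<longrightarrow> f xs = 0}" by (auto simp: tuples_def)
next
  fix f assume "f \<in> {f \<in> alt. \<forall>xs. length xs \<noteq> q \<longrightarrow> f xs = 0}"
  then have f: "f \<in> alt" and deg: "\<And>xs. length xs \<noteq> q \<Longrightarrow> f xs = 0" by auto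
  have repeat: "f xs = 0" if "i < j" "j < length xs" "xs ! i = xs ! j" for xs i j
  proof -
    have "xs = take i xs @ xs ! i # drop (Suc i) (take j xs) @ xs ! i # drop (Suc j) xs"
      using that id_take_nth_drop[of j xs] id_take_nth_drop[of i "take j xs"]
      by (simp add: min_def) (metis append_Cons append_assoc)
    then show ?thesis using alt_repeat[OF f] by metis
  qed
  have add: "f (xs[j := x + y]) = f (xs[j := x]) + f (xs[j := y])"
    if "j < length xs" "x \<in> I" "y \<in> I" for xs j x y
    using that by (simp add: upd_conv_take_nth_drop alt_add[OF f])
  have scale: "f (xs[j := sG a x]) = sM a (f (xs[j := x]))" if "j < length xs" "x \<in> I" for xs j x a
    using that by (simp add: upd_conv_take_nth_drop alt_scale[OF f])
  have outside: "f xs = 0" if "xs \<notin> tuples I q" for xs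
    using that deg alt_outside[OF f] by (auto simp: tuples_def)
  have length: "xs \<in> tuples I q \<Longrightarrow> length xs = q" for xs by (simp add: tuples_def)
  show "f \<in> cochains sG sM I q"
    unfolding cochains_def
  proof (intro CollectI conjI ballI allI impI; (elim conjE)?)
    show "f xs = 0" if "xs \<in> tuples I q" "i < j" "j < q" "xs ! i = xs ! j" for xs i j
      using repeat[of i j xs] length[of xs] that by simp
  qed (simp_all add: outside add scale length)
qed

section \<open>Linear operations and contraction on alternating functions\<close>

lemma alt_zero: "0 \<in> alt"
  by (auto intro!: altI)

lemma alt_plus: "f \<in> alt \<Longrightarrow> g \<in> alt \<Longrightarrow> f + g \<in> alt"
  by (rule altI) (simp_all add: alt_outside alt_add alt_scale alt_adjacent M.scale_right_distrib)

lemma alt_cochain_scale: "f \<in> alt \<Longrightarrow> cochain_scale sM a f \<in> alt"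
  by (rule altI) (simp_all add: cochain_scale_def alt_outside alt_add alt_scale alt_adjacent
      M.scale_right_distrib M.scale_left_commute)

lemma contract_apply: "contract z f xs = f (z # xs)"
  by (simp add: contract_def)

lemma cochain_scale_apply: "cochain_scale sM a f xs = sM a (f xs)"
  by (simp add: cochain_scale_def)

lemma alt_contract:
  assumes "f \<in> alt"
  shows "contract z f \<in> alt"
proof (rule altI)
  fix us vs x y assume "x \<in> I" "y \<in> I"
  then show "contract z f (us @ (x + y) # vs) = contract z f (us @ x # vs) + contract z f (us @ y # vs)"
    using alt_add[OF assms, of x y "z # us"] by (simp add: contract_def)
next
  fix us vs x a assume "x \<in> I"
  then show "contract z f (us @ sG a x # vs) = sM a (contract z f (us @ x # vs))"
    using alt_scale[OF assms, of x "z # us"] by (simp add: contract_def)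
next
  fix us vs x
  show "contract z f (us @ x # x # vs) = 0"
    using alt_adjacent[OF assms, of "z # us"] by (simp add: contract_def)
qed (use alt_outside[OF assms] in \<open>auto simp: contract_def\<close>)

lemma contract_plus: "contract z (f + g) = contract z f + contract z g"
  by (simp add: contract_def fun_eq_iff)

lemma contract_cochain_scale: "contract z (cochain_scale sM a f) = cochain_scale sM a (contract z f)"
  by (simp add: contract_def cochain_scale_def)

lemma contract_add:
  "f \<in> alt \<Longrightarrow> x \<in> I \<Longrightarrow> y \<in> I \<Longrightarrow> contract (x + y) f = contract x f + contract y f"
  using alt_add[of f x y "[]"] by (simp add: contract_def fun_eq_iff)

lemma contract_scale:
  "f \<in> alt \<Longrightarrow> x \<in> I \<Longrightarrow> contract (sG a x) f = cochain_scale sM a (contract x f)"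
  using alt_scale[of f x "[]"] by (simp add: contract_def cochain_scale_def fun_eq_iff)

lemma contract_zero: "f \<in> alt \<Longrightarrow> contract 0 f = 0"
  using contract_add[of f 0 0] I_zero by simp

lemma contract_contract: "f \<in> alt \<Longrightarrow> contract x (contract y f) = - contract y (contract x f)"
  using alt_swap[of f "[]" y x] by (simp add: contract_def fun_eq_iff)

lemma contract_contract_same: "f \<in> alt \<Longrightarrow> contract x (contract x f) = 0"
  using alt_adjacent[of f "[]"] by (simp add: contract_def fun_eq_iff)

subsection \<open>The action on cochains\<close>

lemma theta_Nil: "\<theta> z f [] = act z (f [])"
  by (simp add: theta_def)

lemma theta_outside: "\<not> set xs \<subseteq> I \<Longrightarrow> \<theta> z f xs = 0"
  by (simp add: theta_def)

text \<open>The first summand of the sum is split off and the others belong to the contracted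
  cochain. This recursion drives the inductions on lists below.\<close>

lemma theta_Cons: "a \<in> I \<Longrightarrow> set xs \<subseteq> I \<Longrightarrow> \<theta> z f (a # xs) = \<theta> z (contract a f) xs - f (br z a # xs)"
  by (simp add: theta_def contract_def sum.lessThan_Suc_shift del: sum.lessThan_Suc)

lemma theta_plus: "\<theta> z (f + g) = \<theta> z f + \<theta> z g"
  by (rule ext) (simp add: theta_def act_add sum.distrib)

lemma theta_zero: "\<theta> z 0 = 0"
  using theta_plus[of z 0 0] by simp

lemma theta_minus: "\<theta> z (- f) = - \<theta> z f"
  using theta_plus[of z f "- f"] by (simp add: theta_zero eq_neg_iff_add_eq_0 add.commute)

lemma theta_diff: "\<theta> z (f - g) = \<theta> z f - \<theta> z g"
  using theta_plus[of z f "- g"] by (simp add: theta_minus)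

lemma theta_cochain_scale: "\<theta> z (cochain_scale sM a f) = cochain_scale sM a (\<theta> z f)"
  by (rule ext) (simp add: theta_def cochain_scale_def act_scale_right
      M.scale_right_diff_distrib M.scale_sum_right)

text \<open>\<open>theta_Cons\<close> as an identity of functions: off the lists over
  \<open>I\<close> both sides vanish, the last term because \<open>f\<close> is in
  \<open>alt\<close>.\<close>

lemma contract_theta:
  assumes "f \<in> alt" "z \<in> I"
  shows "contract z (\<theta> x f) = \<theta> x (contract z f) - contract (br x z) f"
proof
  fix xs show "contract z (\<theta> x f) xs = (\<theta> x (contract z f) - contract (br x z) f) xs"
    using assms
    by (cases "set xs \<subseteq> I") (auto simp: contract_apply theta_Cons theta_outside alt_outside)
qed

text \<open>Induction on the prefix \<open>us\<close>: \<open>theta_Cons\<close> strips its first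
  entry by contraction, until the entries concerned stand at the head.\<close>

lemma theta_alt:
  assumes "f \<in> alt"
  shows "\<theta> z f \<in> alt"
proof (rule altI)
  fix us vs x y assume "x \<in> I" "y \<in> I"
  then show "\<theta> z f (us @ (x + y) # vs) = \<theta> z f (us @ x # vs) + \<theta> z f (us @ y # vs)"
    using assms
  proof (induction us arbitrary: f)
    case Nil
    then show ?case
      using alt_add[of f "br z x" "br z y" "[]"]
      by (cases "set vs \<subseteq> I")
        (simp_all add: theta_Cons theta_outside contract_add theta_plus br_add br_I I_add)
  next
    case (Cons u us)
    then show ?case
      using alt_add[of f x y "br z u # us"]
      by (cases "set (u # us @ vs) \<subseteq> I")
        (auto simp: theta_Cons theta_outside alt_contract I_add)
  qed
next
  fix us vs x a assume "x \<in> I"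
  then show "\<theta> z f (us @ sG a x # vs) = sM a (\<theta> z f (us @ x # vs))"
    using assms
  proof (induction us arbitrary: f)
    case Nil
    then show ?case
      using alt_scale[of f "br z x" "[]"]
      by (cases "set vs \<subseteq> I")
        (simp_all add: theta_Cons theta_outside contract_scale theta_cochain_scale br_scale_right br_I I_scale
          cochain_scale_apply M.scale_right_diff_distrib)
  next
    case (Cons u us)
    then show ?case
      using alt_scale[of f x "br z u # us"]
      by (cases "set (u # us @ vs) \<subseteq> I")
        (auto simp: theta_Cons theta_outside alt_contract I_scale M.scale_right_diff_distrib)
  qed
next
  fix us vs x
  show "\<theta> z f (us @ x # x # vs) = 0"
    using assms
  proof (induction us arbitrary: f)
    case Nil
    \<comment> \<open>The terms with \<open>br z x\<close> before \<open>x\<close> and with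
      \<open>x\<close> before \<open>br z x\<close> cancel by a swap.\<close>
    then show ?case
      using alt_swap[of f "[]" x "br z x"]
      by (cases "set (x # vs) \<subseteq> I")
        (auto simp: theta_Cons theta_outside contract_contract_same theta_zero contract_apply)
  next
    case (Cons u us)
    then show ?case
      using alt_adjacent[of f "br z u # us"]
      by (cases "set (u # us @ x # vs) \<subseteq> I")
        (auto simp: theta_Cons theta_outside alt_contract)
  qed
qed (rule theta_outside)

lemma theta_add_left:
  assumes "f \<in> alt"
  shows "\<theta> (x + y) f = \<theta> x f + \<theta> y f"
proof
  fix xs show "\<theta> (x + y) f xs = (\<theta> x f + \<theta> y f) xs"
    using assms
  proof (induction xs arbitrary: f)
    case Nil
    then show ?case by (simp add: theta_Nil act_add)
  next
    case (Cons a xs)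
    then show ?case
      using alt_add[of f "br x a" "br y a" "[]"]
      by (cases "set (a # xs) \<subseteq> I") (auto simp: theta_Cons theta_outside alt_contract br_add br_I)
  qed
qed

lemma theta_scale_left:
  assumes "f \<in> alt"
  shows "\<theta> (sG a x) f = cochain_scale sM a (\<theta> x f)"
proof
  fix xs show "\<theta> (sG a x) f xs = cochain_scale sM a (\<theta> x f) xs"
    using assms
  proof (induction xs arbitrary: f)
    case Nil
    then show ?case by (simp add: theta_Nil act_scale_left cochain_scale_def)
  next
    case (Cons y xs)
    then show ?case
      using alt_scale[of f "br x y" "[]"]
      by (cases "set (y # xs) \<subseteq> I")
        (auto simp: theta_Cons theta_outside alt_contract br_scale_left br_I cochain_scale_def
          M.scale_right_diff_distrib)
  qed
qed

lemma theta_zero_left: "f \<in> alt \<Longrightarrow> \<theta> 0 f = 0"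
  using theta_add_left[of f 0 0] by simp

lemma theta_minus_left: "f \<in> alt \<Longrightarrow> \<theta> (- x) f = - \<theta> x f"
  using theta_add_left[of f x "- x"] by (simp add: theta_zero_left eq_neg_iff_add_eq_0 add.commute)

lemma theta_diff_left: "f \<in> alt \<Longrightarrow> \<theta> (x - y) f = \<theta> x f - \<theta> y f"
  using theta_add_left[of f x "- y"] by (simp add: theta_minus_left)

text \<open>On the empty list this is the module law; each further entry \<open>a\<close>
  contributes brackets with \<open>a\<close>, which match by the Jacobi identity.\<close>

lemma theta_commutator:
  assumes "f \<in> alt"
  shows "\<theta> (br x y) f = \<theta> x (\<theta> y f) - \<theta> y (\<theta> x f)"
proof
  fix xs show "\<theta> (br x y) f xs = (\<theta> x (\<theta> y f) - \<theta> y (\<theta> x f)) xs"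
    using assms
  proof (induction xs arbitrary: f)
    case Nil
    then show ?case by (simp add: theta_Nil act_commutator)
  next
    case (Cons a xs)
    show ?case
    proof (cases "set (a # xs) \<subseteq> I")
      case True
      then have I: "a \<in> I" "set xs \<subseteq> I" by auto
      \<comment> \<open>Serves to evaluate the identity of contractions below at
        \<open>xs\<close>.\<close>
      have f: "f = g + h \<Longrightarrow> f xs = g xs + h xs" for f g h :: "'g list \<Rightarrow> 'm" by simp
      have eq: "br x (br y a) = br (br x y) a + br y (br x a)" by (simp add: br_br)
      have "contract (br x (br y a)) f = contract (br (br x y) a) f + contract (br y (br x a)) f"
        using contract_add[OF Cons.prems, of "br (br x y) a" "br y (br x a)"] I by (simp add: eq br_I)
      from f[OF this] show ?thesis
        using I Cons.IH[OF alt_contract[OF Cons.prems, of a]] Cons.prems alt_outside theta_alt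
        by (simp add: theta_Cons contract_theta alt_outside theta_diff br_I)
          (simp add: theta_Cons br_I contract_apply)
    next
      case False
      then show ?thesis by (simp add: theta_outside)
    qed
  qed
qed

subsection \<open>The differential\<close>

lemma nths_Cons_Compl:
  "nths (x # xs) (- {0}) = xs"
  "nths (x # xs) (- {Suc j}) = x # nths xs (- {j})"
  "nths (x # xs) (- {0, Suc j}) = nths xs (- {j})"
  "nths (x # xs) (- {Suc i, Suc j}) = x # nths xs (- {i, j})"
proof -
  have eqs: "{j. Suc j \<in> - {0}} = UNIV" "{k. Suc k \<in> - {Suc j}} = - {j}"
    "{k. Suc k \<in> - {0, Suc j}} = - {j}" "{k. Suc k \<in> - {Suc i, Suc j}} = - {i, j}"
    by auto
  show "nths (x # xs) (- {0}) = xs"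
    "nths (x # xs) (- {Suc j}) = x # nths xs (- {j})"
    "nths (x # xs) (- {0, Suc j}) = nths xs (- {j})"
    "nths (x # xs) (- {Suc i, Suc j}) = x # nths xs (- {i, j})"
    by (simp_all only: nths_Cons eqs) (simp_all add: nths_all)
qed

text \<open>Bringing \<open>a\<close> from the front to position \<open>j\<close> takes
  \<open>j\<close> transpositions. This matches the bracket terms of \<open>d\<close> with those of
  \<theta>.\<close>

lemma alt_move:
  assumes "f \<in> alt" "j < length xs"
  shows "f (a # nths xs (- {j})) = sM ((- 1) ^ j) (f (xs[j := a]))"
  using assms
proof (induction xs arbitrary: f j)
  case (Cons x xs)
  show ?case
  proof (cases j)
    case (Suc i)
    have "f (a # x # nths xs (- {i})) = - contract x f (a # nths xs (- {i}))"
      using alt_swap[OF Cons.prems(1), of "[]" a x] by (simp add: contract_apply)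
    moreover have "contract x f (a # nths xs (- {i})) = sM ((- 1) ^ i) (contract x f (xs[i := a]))"
      using Cons Suc by (simp add: alt_contract)
    ultimately show ?thesis
      by (simp add: Suc nths_Cons_Compl contract_apply)
  qed (simp add: nths_Cons_Compl)
qed simp

lemma d_Nil: "d f [] = 0"
  by (simp add: ce_diff_def)

lemma d_outside: "\<not> set xs \<subseteq> I \<Longrightarrow> d f xs = 0"
  by (simp add: ce_diff_def)

text \<open>
  Cartan's formula \<open>i\<^sub>z d + d i\<^sub>z = \<theta>\<^sub>z\<close>. Read as a recursion for \<open>d\<close> on the length of the argument,
  it yields every further property of \<open>d\<close> by induction, without index manipulation.
\<close>
lemma d_Cons:
  assumes f: "f \<in> alt" and I: "z \<in> I" "set xs \<subseteq> I"
  shows "d f (z # xs) = \<theta> z f xs - d (contract z f) xs"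
proof -
  let ?g = "\<lambda>ys i j. sM ((- 1) ^ (i + j)) (f (br (ys ! i) (ys ! j) # nths ys (- {i, j})))"
  let ?n = "length xs"
  \<comment> \<open>Pairs containing \<open>z\<close>: the sign of exponent \<open>Suc j\<close>
    meets the sign of exponent \<open>j\<close> from \<open>alt_move\<close>, which leaves a
    minus.\<close>
  have 0: "?g (z # xs) 0 (Suc j) = - f (xs[j := br z (xs ! j)])" if "j < ?n" for j
    using alt_move[OF f that, of "br z (xs ! j)"]
    by (simp add: nths_Cons_Compl flip: power_add mult_2)
  \<comment> \<open>Pairs without \<open>z\<close>: both positions shift by one, so the sign stays;
    the minus comes from moving \<open>z\<close> in front of the bracket.\<close>
  have Suc: "?g (z # xs) (Suc i) (Suc j) =
    - sM ((- 1) ^ (i + j)) (contract z f (br (xs ! i) (xs ! j) # nths xs (- {i, j})))" for i j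
    using alt_swap[OF f, of "[]" "br (xs ! i) (xs ! j)" z "nths xs (- {i, j})"]
    by (simp add: nths_Cons_Compl contract_apply)
  have "(\<Sum>j<Suc ?n. \<Sum>i<j. ?g (z # xs) i j) =
    (\<Sum>j<?n. ?g (z # xs) 0 (Suc j) + (\<Sum>i<j. ?g (z # xs) (Suc i) (Suc j)))"
    by (simp only: sum.lessThan_Suc_shift[of _ ?n] sum.lessThan_Suc_shift[of _ j for j]) simp
  also have "\<dots> = - (\<Sum>j<?n. f (xs[j := br z (xs ! j)])) -
    (\<Sum>j<?n. \<Sum>i<j. sM ((- 1) ^ (i + j)) (contract z f (br (xs ! i) (xs ! j) # nths xs (- {i, j}))))"
  proof -
    have "(\<Sum>j<?n. ?g (z # xs) 0 (Suc j)) = - (\<Sum>j<?n. f (xs[j := br z (xs ! j)]))"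
      unfolding sum_negf[symmetric] by (rule sum.cong) (simp_all only: 0 lessThan_iff)
    then show ?thesis by (simp only: Suc sum.distrib sum_negf) simp
  qed
  finally have 2: "(\<Sum>j<Suc ?n. \<Sum>i<j. ?g (z # xs) i j) = \<dots>" .
  \<comment> \<open>Omitting \<open>z\<close> itself gives the action term of \<theta>; for the
    other entries the shift of position changes the sign.\<close>
  have 1: "(\<Sum>i<Suc ?n. sM ((- 1) ^ i) (act ((z # xs) ! i) (f (nths (z # xs) (- {i}))))) =
    act z (f xs) - (\<Sum>i<?n. sM ((- 1) ^ i) (act (xs ! i) (contract z f (nths xs (- {i})))))"
    by (simp add: sum.lessThan_Suc_shift nths_Cons_Compl contract_apply sum_negf del: sum.lessThan_Suc)
  show ?thesis
    using I 1 2 by (simp add: ce_diff_def theta_def)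
qed

lemma d_plus:
  assumes "f \<in> alt" "g \<in> alt"
  shows "d (f + g) = d f + d g"
proof
  fix xs show "d (f + g) xs = (d f + d g) xs"
    using assms
  proof (induction xs arbitrary: f g)
    case (Cons z xs)
    have "d (f + g) xs = (d f + d g) xs" if "f \<in> alt" "g \<in> alt" for f g
      by (rule Cons.IH[OF that])
    then show "d (f + g) (z # xs) = (d f + d g) (z # xs)"
      using d_Cons[OF alt_plus[OF Cons.prems], of z xs] Cons.prems
      by (cases "set (z # xs) \<subseteq> I")
        (simp_all add: d_Cons d_outside alt_contract contract_plus theta_plus)
  qed (simp add: d_Nil)
qed

lemma d_cochain_scale:
  assumes "f \<in> alt"
  shows "d (cochain_scale sM a f) = cochain_scale sM a (d f)"
proof
  fix xs show "d (cochain_scale sM a f) xs = cochain_scale sM a (d f) xs"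
    using assms
  proof (induction xs arbitrary: f)
    case (Cons z xs)
    have "d (cochain_scale sM a f) xs = cochain_scale sM a (d f) xs" if "f \<in> alt" for f
      by (rule Cons.IH[OF that])
    then show "d (cochain_scale sM a f) (z # xs) = cochain_scale sM a (d f) (z # xs)"
      using d_Cons[OF alt_cochain_scale[OF Cons.prems], of z xs a] Cons.prems
      by (cases "set (z # xs) \<subseteq> I")
        (simp_all add: d_Cons d_outside alt_contract contract_cochain_scale
          theta_cochain_scale cochain_scale_apply M.scale_right_diff_distrib)
  qed (simp add: d_Nil cochain_scale_apply)
qed

lemma d_zero: "d 0 = 0"
  using d_plus[of 0 0] alt_zero by simp

lemma alt_minus: "f \<in> alt \<Longrightarrow> - f \<in> alt"
  using alt_cochain_scale[of f "- 1"] by (simp add: cochain_scale_def fun_Compl_def)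

lemma d_diff:
  assumes "f \<in> alt" "g \<in> alt"
  shows "d (f - g) = d f - d g"
proof -
  have "d f = d (f - g) + d g"
    using d_plus[of "f - g" g] alt_plus[of f "- g"] alt_minus[of g] assms by simp
  then show ?thesis by simp
qed

text \<open>Cartan's formula reduces both sides to shorter lists; the terms with
  \<open>br x z\<close> agree by \<open>contract_theta\<close> and
  \<open>theta_commutator\<close>.\<close>

lemma d_theta:
  assumes "f \<in> alt"
  shows "d (\<theta> x f) = \<theta> x (d f)"
proof
  fix xs show "d (\<theta> x f) xs = \<theta> x (d f) xs"
    using assms
  proof (induction xs arbitrary: f)
    case Nil
    then show ?case by (simp add: theta_Nil d_Nil act_zero)
  next
    case (Cons z xs)
    show ?case
    proof (cases "set (z # xs) \<subseteq> I")
      case True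
      then have I: "z \<in> I" "set xs \<subseteq> I" by auto
      \<comment> \<open>Cartan's formula is lifted to an identity of functions, so that
        \<open>\<theta> x\<close> can be applied to it.\<close>
      have "contract z (d f) ys = (\<theta> z f - d (contract z f)) ys" for ys
        using I(1) Cons.prems
        by (cases "set ys \<subseteq> I") (auto simp: contract_apply d_Cons d_outside theta_outside)
      then have contract_d: "contract z (d f) = \<theta> z f - d (contract z f)" ..
      have "d (\<theta> x f) (z # xs) = \<theta> z (\<theta> x f) xs - d (\<theta> x (contract z f)) xs + d (contract (br x z) f) xs"
        using I Cons.prems
        by (simp add: d_Cons theta_alt contract_theta alt_outside d_diff alt_contract)
      also have "d (\<theta> x (contract z f)) xs = \<theta> x (d (contract z f)) xs"
        by (intro Cons.IH alt_contract Cons.prems)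
      also have "\<theta> z (\<theta> x f) = \<theta> x (\<theta> z f) - \<theta> (br x z) f"
        using theta_commutator[OF Cons.prems] by simp
      finally show ?thesis
        using I Cons.prems by (simp add: theta_Cons contract_d theta_diff d_Cons br_I)
    next
      case False
      then show ?thesis by (simp add: theta_outside d_outside)
    qed
  qed
qed

subsection \<open>Relative cochains\<close>

abbreviation "C \<equiv> rel_cochains sG sM br act I"

lemma cochain_space: "vector_space (cochain_scale sM :: 'f \<Rightarrow> ('g list \<Rightarrow> 'm) \<Rightarrow> _)"
  by unfold_locales
    (auto simp: cochain_scale_def M.scale_right_distrib M.scale_left_distrib)

interpretation F: vector_space "cochain_scale sM :: 'f \<Rightarrow> ('g list \<Rightarrow> 'm) \<Rightarrow> 'g list \<Rightarrow> 'm"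
  by (rule cochain_space)

lemma rel_cochains_eq: "C K q =
  {f \<in> alt. (\<forall>xs. length xs \<noteq> q \<longrightarrow> f xs = 0) \<and> (\<forall>y\<in>K. contract y f = 0 \<and> \<theta> y f = 0)}"
  by (auto simp: rel_cochains_def cochains_eq)

lemma rel_cochains_alt: "f \<in> C K q \<Longrightarrow> f \<in> alt"
  by (simp add: rel_cochains_eq)

lemma contract_zero_fun: "contract z 0 = 0"
  by (simp add: contract_def fun_eq_iff)

lemma subspace_rel_cochains: "F.subspace (C K q)"
  by (auto simp: F.subspace_def rel_cochains_eq alt_zero alt_plus alt_cochain_scale contract_zero_fun
      contract_plus contract_cochain_scale theta_zero theta_plus theta_cochain_scale cochain_scale_apply)

lemma subspace_rel_cocycles: "F.subspace (rel_cocycles sG sM br act I K q)"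
  using subspace_rel_cochains[of K q]
  by (auto simp: F.subspace_def rel_cocycles_def d_zero d_plus d_cochain_scale rel_cochains_alt)

lemma subspace_rel_coboundaries: "F.subspace (rel_coboundaries sG sM br act I K q)"
proof (cases q)
  case (Suc p)
  have "F.subspace (d ` C K p)"
    unfolding F.subspace_def
  proof (intro conjI ballI allI)
    note sub = subspace_rel_cochains[of K p]
    show "0 \<in> d ` C K p" using F.subspace_0[OF sub] d_zero by (metis imageI)
    show "u + v \<in> d ` C K p" if "u \<in> d ` C K p" "v \<in> d ` C K p" for u v
      using that F.subspace_add[OF sub] d_plus rel_cochains_alt
      by (elim imageE) (metis image_eqI)
    show "cochain_scale sM a u \<in> d ` C K p" if "u \<in> d ` C K p" for a u
      using that F.subspace_scale[OF sub] d_cochain_scale rel_cochains_alt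
      by (elim imageE) (metis image_eqI)
  qed
  then show ?thesis by (simp add: rel_coboundaries_def Suc)
qed (simp add: rel_coboundaries_def F.subspace_single_0)

text \<open>Since \<open>x\<close> centralises \<open>K\<close>, \<open>\<theta> x\<close> commutes
  with contraction by and \<theta> of each element of \<open>K\<close>, hence preserves their common
  kernel.\<close>

lemma theta_rel_cochains:
  assumes K: "K \<subseteq> I" and x: "\<And>y. y \<in> K \<Longrightarrow> br x y = 0" and f: "f \<in> C K q"
  shows "\<theta> x f \<in> C K q"
proof -
  have alt: "f \<in> alt" by (rule rel_cochains_alt[OF f])
  have "contract y (\<theta> x f) = 0" "\<theta> y (\<theta> x f) = 0" if "y \<in> K" for y
  proof -
    have y: "contract y f = 0" "\<theta> y f = 0" "y \<in> I"
      using f that K by (auto simp: rel_cochains_eq)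
    show "contract y (\<theta> x f) = 0"
      using contract_theta[of f y x] alt y
      by (simp add: alt_outside x[OF that] theta_zero contract_zero)
    show "\<theta> y (\<theta> x f) = 0"
      using theta_commutator[OF alt, of x y] y
      by (simp add: x[OF that] theta_zero theta_zero_left[OF alt])
  qed
  moreover have "\<theta> x f xs = 0" if "length xs \<noteq> q" for xs
    using f that by (simp add: theta_def rel_cochains_eq act_zero)
  ultimately show ?thesis by (simp add: rel_cochains_eq theta_alt alt)
qed

lemma theta_rel_cocycles:
  assumes "K \<subseteq> I" "\<And>y. y \<in> K \<Longrightarrow> br x y = 0" "f \<in> rel_cocycles sG sM br act I K q"
  shows "\<theta> x f \<in> rel_cocycles sG sM br act I K q"
  using assms theta_rel_cochains[OF assms(1,2)]
  by (auto simp: rel_cocycles_def d_theta rel_cochains_alt theta_zero)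

lemma theta_rel_coboundaries:
  assumes "K \<subseteq> I" "\<And>y. y \<in> K \<Longrightarrow> br x y = 0" "f \<in> rel_coboundaries sG sM br act I K q"
  shows "\<theta> x f \<in> rel_coboundaries sG sM br act I K q"
proof (cases q)
  case (Suc p)
  with assms(3) obtain g where "g \<in> C K p" "f = d g" by (auto simp: rel_coboundaries_def)
  then have "\<theta> x f = d (\<theta> x g)" "\<theta> x g \<in> C K p"
    using theta_rel_cochains[OF assms(1,2)] by (simp_all add: d_theta rel_cochains_alt)
  then show ?thesis by (simp add: rel_coboundaries_def Suc)
qed (use assms(3) in \<open>simp add: rel_coboundaries_def theta_zero\<close>)

lemma theta_rel_cocycles_coboundary:
  assumes z: "z \<in> I" "\<And>y. y \<in> K \<Longrightarrow> br z y = 0" and K: "K \<subseteq> I"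
    and c: "c \<in> rel_cocycles sG sM br act I K q"
  shows "\<theta> z c \<in> rel_coboundaries sG sM br act I K q"
proof -
  have f: "c \<in> C K q" and dc: "d c = 0" using c by (auto simp: rel_cocycles_def)
  have alt: "c \<in> alt" by (rule rel_cochains_alt[OF f])
  \<comment> \<open>In Cartan's formula the term with \<open>d c\<close> drops out.\<close>
  have "\<theta> z c xs = d (contract z c) xs" for xs
  proof (cases "set xs \<subseteq> I")
    case True
    then show ?thesis using d_Cons[OF alt z(1), of xs] by (simp add: dc)
  qed (simp add: theta_outside d_outside)
  then have eq: "\<theta> z c = d (contract z c)" ..
  have deg: "c xs = 0" if "length xs \<noteq> q" for xs using f that by (simp add: rel_cochains_eq)
  show ?thesis
  proof (cases q)
    case 0
    \<comment> \<open>A cochain of degree 0 lives on the empty list, so its contraction vanishes,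
      and the only coboundary is 0.\<close>
    then have "contract z c = 0" by (simp add: contract_def fun_eq_iff deg)
    then show ?thesis by (simp add: eq d_zero rel_coboundaries_def 0)
  next
    case (Suc p)
    \<comment> \<open>Contractions anticommute, and \<theta> of \<open>y\<close> commutes with
      contraction by \<open>z\<close> because \<open>br y z = 0\<close>; so the primitive is again
      relative.\<close>
    have "contract y (contract z c) = 0" "\<theta> y (contract z c) = 0" if "y \<in> K" for y
    proof -
      have y: "contract y c = 0" "\<theta> y c = 0" using f that by (auto simp: rel_cochains_eq)
      show "contract y (contract z c) = 0"
        using contract_contract[OF alt, of y z] y by (simp add: contract_zero_fun)
      show "\<theta> y (contract z c) = 0"
        using contract_theta[of c z y] alt z that y br_skew[of z y]
        by (simp add: alt_outside contract_zero_fun contract_zero)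
    qed
    then have "contract z c \<in> C K p"
      by (simp add: rel_cochains_eq alt_contract[OF alt] contract_apply deg Suc)
    then show ?thesis by (simp add: eq rel_coboundaries_def Suc)
  qed
qed

section \<open>The complement of the ideal and the action on cohomology\<close>

lemma ad_submodule_sum:
  assumes "ad_submodule sG br k U" "ad_submodule sG br k V"
  shows "ad_submodule sG br k (U + V)"
proof -
  have eq: "U + V = {u + v |u v. u \<in> U \<and> v \<in> V}" by (auto simp: set_plus_def)
  have "G.subspace (U + V)"
    using assms G.subspace_sums[of U V] by (simp add: ad_submodule_def eq)
  moreover have "br x w \<in> U + V" if "x \<in> k" "w \<in> U + V" for x w
    using \<open>w \<in> U + V\<close>
  proof (rule set_plus_elim)
    fix u v assume "w = u + v" "u \<in> U" "v \<in> V"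
    with \<open>x \<in> k\<close> assms show ?thesis by (auto simp: ad_submodule_def br_add)
  qed
  ultimately show ?thesis by (simp add: ad_submodule_def)
qed

text \<open>As an element of \<open>k\<close>, \<open>y\<close> maps \<open>J\<close> into itself;
  as an element of the ideal, it sends everything into \<open>I\<close>.\<close>

lemma complement_commutes:
  assumes "ad_submodule sG br k J" "direct_sum_of UNIV I J" "x \<in> J" "y \<in> I" "y \<in> k"
  shows "br x y = 0"
proof -
  have "br y x \<in> J" "G.subspace J" using assms by (auto simp: ad_submodule_def)
  then have "br x y \<in> J" using G.subspace_neg[of J "br y x"] br_skew[of x y] by auto
  moreover have "br x y \<in> I" by (rule br_I) fact
  ultimately show ?thesis using assms(2) by (auto simp: direct_sum_of_def)
qed

lemma rel_cohomology_action:
  fixes Ik J :: "'g set" and q :: nat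
  defines "Z \<equiv> rel_cocycles sG sM br act I Ik q"
    and "B \<equiv> rel_coboundaries sG sM br act I Ik q"
    and "H \<equiv> rel_cohomology sG sM br act I Ik q"
    and "sH \<equiv> quot_scale (cochain_scale sM) (rel_coboundaries sG sM br act I Ik q)"
  assumes Ik: "Ik \<subseteq> I" and J: "module.subspace sG J" and sum: "direct_sum_of UNIV I J"
    and comm_J: "\<And>x y. x \<in> J \<Longrightarrow> y \<in> Ik \<Longrightarrow> br x y = 0"
  shows "(\<forall>x. \<forall>c\<in>Z. \<theta> (proj_along I J x) c \<in> Z) \<and>
    (\<exists>actH. lie_module_on UNIV 0 sG br H B sH actH \<and>
       (\<forall>x. \<forall>c\<in>Z. actH x (c +o B) = \<theta> (proj_along I J x) c +o B) \<and>
       (\<forall>x\<in>I. \<forall>h\<in>H. actH x h = B)) \<and>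
    (\<exists>actQ. lie_module_on (quot UNIV I) I (quot_scale sG I) (quot_br br I) H B sH actQ \<and>
       (\<forall>x. \<forall>c\<in>Z. actQ (x +o I) (c +o B) = \<theta> (proj_along I J x) c +o B))"
proof -
  have vs: "vector_space sG" by (rule G.vector_space_axioms)
  define p where "p = proj_along I J"
  have p_J: "p x \<in> J" and p_I: "x - p x \<in> I" for x
    unfolding p_def by (rule proj_along_mem[OF vs I_subspace J sum])+
  have p_eq: "p x = y" if "y \<in> J" "x - y \<in> I" for x y
    unfolding p_def by (rule proj_along_eq[OF vs I_subspace J sum that])
  have p_add: "p (x + y) = p x + p y" for x y
    using I_add[OF p_I[of x] p_I[of y]] by (intro p_eq G.subspace_add[OF J] p_J) (simp add: algebra_simps)
  have p_scale: "p (sG a x) = sG a (p x)" for a x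
    using I_scale[OF p_I[of x], of a]
    by (intro p_eq G.subspace_scale[OF J] p_J) (simp add: G.scale_right_diff_distrib)
  have p_zero: "p x = 0" if "x \<in> I" for x
    using that by (intro p_eq G.subspace_0[OF J]) simp
  have comm: "br (p x) y = 0" if "y \<in> Ik" for x y
    using comm_J[OF p_J that] .
  have alt: "c \<in> alt" if "c \<in> Z" for c
    using that by (auto simp: Z_def rel_cocycles_def intro: rel_cochains_alt)
  have subZ: "F.subspace Z" and subB: "F.subspace B"
    unfolding Z_def B_def by (rule subspace_rel_cocycles subspace_rel_coboundaries)+
  have Z: "\<theta> (p x) c \<in> Z" if "c \<in> Z" for x c
    using theta_rel_cocycles[OF Ik comm] that by (simp add: Z_def)
  have B: "\<theta> (p x) c \<in> B" if "c \<in> B" for x c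
    using theta_rel_coboundaries[OF Ik comm] that by (simp add: B_def)
  have bracket: "\<theta> (p (br x y)) c + \<theta> (p y) (\<theta> (p x) c) - \<theta> (p x) (\<theta> (p y) c) \<in> B"
    if c: "c \<in> Z" for x y c
  proof -
    let ?w = "p (br x y) - br (p x) (p y)"
    have "br (x - p x) y \<in> I" "br (p x) (y - p y) \<in> I"
      using G.subspace_neg[OF I_subspace br_I[OF p_I[of x], of y]] br_skew[of "x - p x" y] br_I[OF p_I]
      by auto
    \<comment> \<open>Telescoping through \<open>br (p x) y\<close>, so that each summand has one
      argument in \<open>I\<close>.\<close>
    moreover have "br x y - br (p x) (p y) = br (x - p x) y + br (p x) (y - p y)"
      using br_add(2)[of "p x" "y - p y" "p y"] by (simp add: br_diff)
    ultimately have "br x y - br (p x) (p y) \<in> I" by (simp add: I_add)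
    from G.subspace_diff[OF I_subspace this p_I[of "br x y"]] have "?w \<in> I" by simp
    moreover have "br ?w z = 0" if "z \<in> Ik" for z
      by (simp add: br_diff br_br comm[OF that] br_zero)
    ultimately have "\<theta> ?w c \<in> B"
      unfolding B_def by (intro theta_rel_cocycles_coboundary Ik c[unfolded Z_def]) auto
    then show ?thesis
      by (simp add: theta_diff_left theta_commutator alt[OF c] algebra_simps)
  qed
  have H: "H = quot Z B" by (simp add: H_def Z_def B_def rel_cohomology_def)
  have sH: "sH = quot_scale (cochain_scale sM) B" by (simp add: sH_def B_def)
  \<comment> \<open>No representative is chosen; \<open>image_coset\<close> recovers the formula on
    cosets.\<close>
  define actH where "actH x A = \<theta> (p x) ` A + B" for x A
  have mod: "lie_module_on UNIV 0 sG br H B sH actH"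
    unfolding H sH actH_def
    by (intro lie_module_on_quot lie_algebra_on_axioms cochain_space subZ subB)
      (simp_all add: theta_plus theta_cochain_scale Z B bracket p_add p_scale
        theta_add_left theta_scale_left alt)
  have actH: "actH x (c +o B) = \<theta> (p x) c +o B" for x c
    unfolding actH_def by (rule image_coset[OF subB cochain_space]) (auto simp: theta_plus B)
  \<comment> \<open>Elements of \<open>I\<close> project to 0, and \<open>\<theta> 0\<close> sends
    every cocycle to 0, whose coset is \<open>B\<close>.\<close>
  have trivial: "actH x h = B" if "x \<in> I" "h \<in> H" for x h
    using that by (auto simp: H actH p_zero theta_zero_left alt zero_coset elim!: quot_cases)
  obtain actQ where "lie_module_on (quot UNIV I) I (quot_scale sG I) (quot_br br I) H B sH actQ"
    and actQ: "\<And>x v. v \<in> H \<Longrightarrow> actQ (x +o I) v = actH x v"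
    using lie_module_on_quot_algebra[OF mod ideal trivial] by blast
  moreover have "actQ (x +o I) (c +o B) = \<theta> (p x) c +o B" if "c \<in> Z" for x c
    using that by (simp add: actQ H coset_in_quot actH)
  ultimately show ?thesis
    using mod actH trivial Z unfolding p_def by blast
qed

end

theorem proposition2p9:
  fixes sG :: "'f::field \<Rightarrow> 'g::ab_group_add \<Rightarrow> 'g"
    and br :: "'g \<Rightarrow> 'g \<Rightarrow> 'g"
    and sM :: "'f \<Rightarrow> 'm::ab_group_add \<Rightarrow> 'm"
    and act :: "'g \<Rightarrow> 'm \<Rightarrow> 'm"
    and I k Ik IL Jk JL J :: "'g set"
    and q :: nat
  defines "Z \<equiv> rel_cocycles sG sM br act I Ik q"
    and "B \<equiv> rel_coboundaries sG sM br act I Ik q"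
    and "H \<equiv> rel_cohomology sG sM br act I Ik q"
    and "sH \<equiv> quot_scale (cochain_scale sM) (rel_coboundaries sG sM br act I Ik q)"
  assumes "lie_algebra_on UNIV 0 sG br"
    and "lie_module_on UNIV 0 sG br UNIV 0 sM act"
    and "lie_ideal sG br I"
    and "lie_subalgebra sG br k"
    and "reductive_in sG br k"
    and "Ik = I \<inter> k"
    and "ad_submodule sG br k IL" and "ad_submodule sG br k Jk" and "ad_submodule sG br k JL"
    and "direct_sum_of I Ik IL"
    and "direct_sum_of k Ik Jk"
    and "direct_sum_of J Jk JL"
    and "direct_sum_of UNIV I J"
  shows "(\<forall>x. \<forall>c\<in>Z. theta br act I (proj_along I J x) c \<in> Z) \<and>
    (\<exists>actH. lie_module_on UNIV 0 sG br H B sH actH \<and>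
       (\<forall>x. \<forall>c\<in>Z. actH x (c +o B) = theta br act I (proj_along I J x) c +o B) \<and>
       (\<forall>x\<in>I. \<forall>h\<in>H. actH x h = B)) \<and>
    (\<exists>actQ. lie_module_on (quot UNIV I) I (quot_scale sG I) (quot_br br I) H B sH actQ \<and>
       (\<forall>x. \<forall>c\<in>Z. actQ (x +o I) (c +o B) = theta br act I (proj_along I J x) c +o B))"
proof -
  have loc: "lie_module_ideal sG br sM act I"
    by (intro lie_module_ideal.intro lie_module_ideal_axioms.intro) fact+
  have J: "ad_submodule sG br k J"
    using lie_module_ideal.ad_submodule_sum[OF loc \<open>ad_submodule sG br k Jk\<close> \<open>ad_submodule sG br k JL\<close>]
      \<open>direct_sum_of J Jk JL\<close> by (simp add: direct_sum_of_def)
  show ?thesis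
    unfolding Z_def B_def H_def sH_def
  proof (rule lie_module_ideal.rel_cohomology_action[OF loc])
    show "Ik \<subseteq> I" using \<open>Ik = I \<inter> k\<close> by simp
    show "module.subspace sG J" using J by (simp add: ad_submodule_def)
    show "br x y = 0" if "x \<in> J" "y \<in> Ik" for x y
      using lie_module_ideal.complement_commutes[OF loc J \<open>direct_sum_of UNIV I J\<close>] that
        \<open>Ik = I \<inter> k\<close> by simp
  qed fact
qed

end
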